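(* Consider the secretary problem on $n$ items where the order of arrival (and the values) is chosen by an adversary. For every (possibly randomized) online algorithm that satisfies the expected capacity constraint of $1$, its competitive ratio is at most $1/n$: there is an input sequence on which the probability that the algorithm selects the item of largest value is at most $1/n$.
   Context: There are $n$ items, each of weight $1$, with real values; an adversary chooses the input sequence (values and order of arrival). On each arrival an online algorithm must irrevocably decide whether to select the item, based on the values seen so far and its internal randomness; selected items cannot be removed and the algorithm may continue selecting. The expected capacity constraint of $1$ requires that on every input sequence the expected number of selected items (over the algorithm's randomness) is at most $1$. The competitive ratio is the minimum over input sequences of the probability that the algorithm selects the item of largest value. *)

theory Defs
  imports "HOL-Probability.Probability"
begin

text \<open>
  The internal randomness is a seed drawn once from an arbitrary probability space M.
  \<open>A \<omega> [v\<^sub>1, \<dots>, v\<^sub>t]\<close> says whether the algorithm with seed \<open>\<omega>\<close> selects the \<open>t\<close>-th arriving item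
  after having seen exactly the values \<open>v\<^sub>1, \<dots>, v\<^sub>t\<close>. Dependence on earlier decisions is covered,
  since they are functions of the seed and of shorter prefixes, and so are fresh coins at each step.
\<close>

definition online_algorithm :: "'w measure \<Rightarrow> ('w \<Rightarrow> real list \<Rightarrow> bool) \<Rightarrow> bool" where
  "online_algorithm M A \<longleftrightarrow>
     prob_space M \<and> (\<forall>xs. {\<omega> \<in> space M. A \<omega> xs} \<in> sets M)"

definition input_sequences :: "nat \<Rightarrow> real list set" where
  "input_sequences n = {v. length v = n}"

definition selected :: "('w \<Rightarrow> real list \<Rightarrow> bool) \<Rightarrow> real list \<Rightarrow> 'w \<Rightarrow> nat set" where
  "selected A v \<omega> = {t. t < length v \<and> A \<omega> (take (Suc t) v)}"

definition expected_capacity_constraint ::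
    "'w measure \<Rightarrow> ('w \<Rightarrow> real list \<Rightarrow> bool) \<Rightarrow> nat \<Rightarrow> real \<Rightarrow> bool" where
  "expected_capacity_constraint M A n c \<longleftrightarrow>
     (\<forall>v \<in> input_sequences n. (\<integral>\<omega>. real (card (selected A v \<omega>)) \<partial>M) \<le> c)"

text \<open>If several items tie for the largest value, selecting any of them counts as a success.\<close>

definition largest_items :: "real list \<Rightarrow> nat set" where
  "largest_items v = {t. t < length v \<and> v ! t = Max (set v)}"

definition success_prob ::
    "'w measure \<Rightarrow> ('w \<Rightarrow> real list \<Rightarrow> bool) \<Rightarrow> real list \<Rightarrow> real" where
  "success_prob M A v =
     measure M {\<omega> \<in> space M. selected A v \<omega> \<inter> largest_items v \<noteq> {}}"

definition competitive_ratio ::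
    "'w measure \<Rightarrow> ('w \<Rightarrow> real list \<Rightarrow> bool) \<Rightarrow> nat \<Rightarrow> real" where
  "competitive_ratio M A n = (INF v \<in> input_sequences n. success_prob M A v)"

end

theory Submission imports Defs begin

text \<open>
  On an increasing sequence the capacity constraint forces some arrival \<open>t\<close> to be selected with
  probability at most \<open>1 / n\<close>. Replacing everything after \<open>t\<close> by smaller values makes item \<open>t\<close> the
  largest, while an online algorithm cannot tell the two inputs apart up to time \<open>t\<close>.
\<close>

text \<open>Linearity of expectation: the cardinality is a sum of indicators of the selection
  events, which \<open>online_algorithm\<close> makes measurable.\<close>

lemma expected_card_selected:
  assumes "online_algorithm M A"
  shows "(\<integral>\<omega>. real (card (selected A v \<omega>)) \<partial>M) =
    (\<Sum>t<length v. measure M {\<omega> \<in> space M. A \<omega> (take (Suc t) v)})"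
proof -
  interpret prob_space M using assms by (simp add: online_algorithm_def)
  let ?E = "\<lambda>t. {\<omega> \<in> space M. A \<omega> (take (Suc t) v)}"
  have E: "?E t \<in> sets M" for t using assms by (simp add: online_algorithm_def)
  have "real (card (selected A v \<omega>)) = (\<Sum>t<length v. indicat_real (?E t) \<omega>)"
    if "\<omega> \<in> space M" for \<omega>
  proof -
    have "selected A v \<omega> = {t \<in> {..<length v}. \<omega> \<in> ?E t}"
      using that by (auto simp: selected_def)
    then show ?thesis
      by (simp add: indicator_def sum.If_cases Int_def)
  qed
  then have "(\<integral>\<omega>. real (card (selected A v \<omega>)) \<partial>M) =
      (\<integral>\<omega>. (\<Sum>t<length v. indicat_real (?E t) \<omega>) \<partial>M)"
    by (intro Bochner_Integration.integral_cong) auto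
  also have "\<dots> = (\<Sum>t<length v. measure M (?E t))"
    using E by (subst Bochner_Integration.integral_sum) (auto simp: less_top[symmetric])
  finally show ?thesis .
qed

text \<open>Success is then a single selection event, and it depends on \<open>v\<close> only
  through the first \<open>Suc t\<close> values.\<close>

lemma success_prob_unique_largest:
  assumes "largest_items v = {t}"
  shows "success_prob M A v = measure M {\<omega> \<in> space M. A \<omega> (take (Suc t) v)}"
proof -
  have "t < length v" using assms by (auto simp: largest_items_def)
  then show ?thesis by (simp add: success_prob_def assms selected_def)
qed

lemma competitive_ratio_le_success_prob:
  assumes "v \<in> input_sequences n"
  shows "competitive_ratio M A n \<le> success_prob M A v"
  unfolding competitive_ratio_def
  \<comment> \<open>A real infimum is known to be a lower bound only for a family bounded below;
    probabilities are bounded below by 0.\<close>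
  by (intro cINF_lower bdd_belowI2[where m = 0] assms) (simp add: success_prob_def)

lemma ex_le_average:
  fixes p :: "nat \<Rightarrow> real"
  assumes "n \<ge> 1" and "(\<Sum>t<n. p t) \<le> c"
  shows "\<exists>t<n. p t \<le> c / real n"
proof (rule ccontr)
  assume "\<not> ?thesis"
  then have "(\<Sum>t<n. c / real n) < (\<Sum>t<n. p t)"
    using assms(1) by (intro sum_strict_mono) (auto simp: not_le lessThan_empty_iff)
  with assms show False by simp
qed

text \<open>The tail is \<open>- real i\<close> rather than a constant so that all values stay
  distinct: \<open>i > t\<close> forces \<open>i\<close> to be positive, so the tail is negative and
  lies below the nonnegative prefix.\<close>

definition rise_then_drop :: "nat \<Rightarrow> nat \<Rightarrow> real list" where
  "rise_then_drop n t = map (\<lambda>i. if i \<le> t then real i else - real i) [0..<n]"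

lemma length_rise_then_drop [simp]: "length (rise_then_drop n t) = n"
  by (simp add: rise_then_drop_def)

lemma distinct_rise_then_drop: "distinct (rise_then_drop n t)"
  by (auto simp: rise_then_drop_def distinct_map inj_on_def)

lemma take_rise_then_drop:
  "t < n \<Longrightarrow> take (Suc t) (rise_then_drop n t) = take (Suc t) (map real [0..<n])"
  by (auto simp: rise_then_drop_def take_map)

lemma largest_items_rise_then_drop:
  assumes "t < n"
  shows "largest_items (rise_then_drop n t) = {t}"
proof -
  have "Max (set (rise_then_drop n t)) = real t"
    using assms by (intro Max_eqI) (auto simp: rise_then_drop_def image_iff intro!: bexI[of _ t])
  then show ?thesis
    using assms by (auto simp: largest_items_def rise_then_drop_def split: if_splits)
qed

theorem theorem1:
  fixes M :: "'w measure" and A :: "'w \<Rightarrow> real list \<Rightarrow> bool" and n :: nat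
  assumes "n \<ge> 1"
    and "online_algorithm M A"
    and "expected_capacity_constraint M A n 1"
  shows "competitive_ratio M A n \<le> 1 / real n \<and>
         (\<exists>v \<in> input_sequences n. distinct v \<and> success_prob M A v \<le> 1 / real n)"
proof -
  \<comment> \<open>Probability of selecting arrival \<open>t\<close> on the increasing input 0, 1,
    ..., n - 1.\<close>
  let ?p = "\<lambda>t. measure M {\<omega> \<in> space M. A \<omega> (take (Suc t) (map real [0..<n]))}"
  have "map real [0..<n] \<in> input_sequences n" by (simp add: input_sequences_def)
  then have "(\<integral>\<omega>. real (card (selected A (map real [0..<n]) \<omega>)) \<partial>M) \<le> 1"
    using assms(3) unfolding expected_capacity_constraint_def by blast
  then have "(\<Sum>t<n. ?p t) \<le> 1"
    unfolding expected_card_selected[OF assms(2)] by (simp only: length_map length_upt diff_zero)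
  then obtain t where t: "t < n" "?p t \<le> 1 / real n"
    using ex_le_average[OF assms(1)] by blast
  let ?v = "rise_then_drop n t"
  have v: "?v \<in> input_sequences n" by (simp add: input_sequences_def)
  have le: "success_prob M A ?v \<le> 1 / real n"
    \<comment> \<open>The success probability on \<open>?v\<close> equals \<open>?p t\<close>,
      because \<open>?v\<close> shares its first \<open>Suc t\<close> values with the increasing
      input.\<close>
    using t by (simp only: success_prob_unique_largest[OF largest_items_rise_then_drop]
        take_rise_then_drop)
  have "competitive_ratio M A n \<le> 1 / real n"
    using competitive_ratio_le_success_prob[OF v] le by (rule order_trans)
  with v le show ?thesis using distinct_rise_then_drop by blast
qed

end
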